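(* Let $G(s)$ be a scalar transfer function that is real and strictly proper. Let $\sigma\in\mathbb R$ and let $\omega\in\mathbb R$ be such that $j\omega$ is not a pole of $G$ and $1-\sigma G(j\omega)\neq0$. Let $H_\sigma(s)=G(s)/(1-\sigma G(s))$. Then $$H_\sigma(j\omega)+H_\sigma^H(j\omega)\ge 0\quad\Longleftrightarrow\quad \Re(G(j\omega))\ \ge\ \sigma\,|G(j\omega)|^2 .$$
   Context: A transfer function is a rational function of the complex variable $s$; "real" means real coefficients. For a scalar, $H^H$ denotes the complex conjugate, so $H_\sigma(j\omega)+H_\sigma^H(j\omega)=2\Re(H_\sigma(j\omega))$. *)

theory Defs
  imports "HOL-Computational_Algebra.Computational_Algebra" "HOL-Computational_Algebra.Field_as_Ring"
    "HOL-Library.Complex_Order"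
begin

text \<open>
  A scalar transfer function is an element of the field of rational functions over the complex
  numbers. \<^const>\<open>quot_of_fract\<close> gives its representation in lowest terms with monic denominator
  (and \<open>(0, 1)\<close> for the zero function).
\<close>

type_synonym transfer_function = "complex poly fract"

definition tf_num :: "transfer_function \<Rightarrow> complex poly" where
  "tf_num G = fst (quot_of_fract G)"

definition tf_den :: "transfer_function \<Rightarrow> complex poly" where
  "tf_den G = snd (quot_of_fract G)"

definition tf_const :: "complex \<Rightarrow> transfer_function" where
  "tf_const c = to_fract [:c:]"

text \<open>The value \<open>tf_eval G s\<close> is meaningful only if \<open>s\<close> is not a pole (it is \<open>0\<close> at a pole).\<close>

definition tf_eval :: "transfer_function \<Rightarrow> complex \<Rightarrow> complex" where
  "tf_eval G s = poly (tf_num G) s / poly (tf_den G) s"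

text \<open>As numerator and denominator are coprime, removable singularities are not poles.\<close>

definition tf_pole :: "transfer_function \<Rightarrow> complex \<Rightarrow> bool" where
  "tf_pole G s \<longleftrightarrow> poly (tf_den G) s = 0"

definition real_tf :: "transfer_function \<Rightarrow> bool" where
  "real_tf G \<longleftrightarrow> (\<exists>p q :: real poly. q \<noteq> 0 \<and>
     G = Fract (map_poly complex_of_real p) (map_poly complex_of_real q))"

text \<open>The zero function is singled out since the library sets \<open>degree 0 = 0\<close>.\<close>

definition strictly_proper :: "transfer_function \<Rightarrow> bool" where
  "strictly_proper G \<longleftrightarrow> G = 0 \<or> degree (tf_num G) < degree (tf_den G)"

text \<open>The quotient is taken in the field of rational functions.\<close>

definition feedback_tf :: "real \<Rightarrow> transfer_function \<Rightarrow> transfer_function" where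
  "feedback_tf \<sigma> G = G / (1 - tf_const (complex_of_real \<sigma>) * G)"

end

theory Submission
  imports Defs
begin

text \<open>Write g for the value of G at the given point. Multiplying numerator and denominator of
  g / (1 - \<sigma> g) by the conjugate of the denominator gives real part (Re g - \<sigma> |g|^2) /
  |1 - \<sigma> g|^2, whose sign is that of its numerator (\<open>Re_feedback_nonneg_iff\<close>).
  It remains to see that the quotient formed in the field of rational functions takes the value g /
  (1 - \<sigma> g) there (\<open>tf_eval_feedback_tf\<close>). As \<open>tf_eval\<close> uses lowest
  terms, this rests on \<open>tf_eval_Fract\<close>, which permits any representation whose
  denominator does not vanish at the point.\<close>

lemma tf_den_nonzero: "tf_den G \<noteq> 0"
  by (simp add: tf_den_def)

lemma Fract_tf_num_tf_den: "Fract (tf_num G) (tf_den G) = G"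
  by (simp add: tf_num_def tf_den_def Fract_quot_of_fract)

text \<open>Coprimality makes the reduced denominator divide any other one, so a nonzero value of the
  latter excludes a pole.\<close>

lemma tf_eval_Fract:
  assumes "poly q s \<noteq> 0"
  shows "tf_eval (Fract p q) s = poly p s / poly q s"
proof -
  let ?G = "Fract p q"
  have "q \<noteq> 0"
    using assms by auto
  then have eq: "tf_num ?G * q = p * tf_den ?G"
    using Fract_tf_num_tf_den[of ?G] by (simp add: tf_den_nonzero eq_fract)
  have "coprime (tf_den ?G) (tf_num ?G)"
    using coprime_quot_of_fract[of ?G] by (simp add: tf_num_def tf_den_def coprime_commute)
  moreover have "tf_den ?G dvd tf_num ?G * q"
    by (simp add: eq)
  ultimately have "tf_den ?G dvd q"
    by (simp add: coprime_dvd_mult_right_iff)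
  then have "poly (tf_den ?G) s \<noteq> 0"
    using assms by (metis dvd_trans poly_eq_0_iff_dvd)
  moreover have "poly (tf_num ?G) s * poly q s = poly p s * poly (tf_den ?G) s"
    using arg_cong[OF eq, of "\<lambda>r. poly r s"] by simp
  ultimately show ?thesis
    using assms by (simp add: tf_eval_def frac_eq_eq)
qed

text \<open>With G = n/d, the denominator 1 - \<sigma> G is (d - \<sigma> n)/d. Its numerator takes
  at s the value d(s) (1 - \<sigma> G(s)), which the two assumptions make nonzero.\<close>

lemma tf_eval_feedback_tf:
  assumes "\<not> tf_pole G s" and "1 - complex_of_real \<sigma> * tf_eval G s \<noteq> 0"
  shows "tf_eval (feedback_tf \<sigma> G) s = tf_eval G s / (1 - complex_of_real \<sigma> * tf_eval G s)"
proof -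
  define n d where "n = tf_num G" and "d = tf_den G"
  let ?r = "d - [:complex_of_real \<sigma>:] * n"
  have d: "d \<noteq> 0" "poly d s \<noteq> 0"
    using assms(1) by (simp_all add: d_def tf_den_nonzero tf_pole_def)
  have G: "G = Fract n d"
    by (simp add: n_def d_def Fract_tf_num_tf_den)
  have eval_G: "tf_eval G s = poly n s / poly d s"
    by (simp add: tf_eval_def n_def d_def)
  have r: "poly ?r s = poly d s * (1 - complex_of_real \<sigma> * tf_eval G s)"
    using d by (simp add: eval_G field_simps)
  have "1 - tf_const (complex_of_real \<sigma>) * G = Fract ?r d"
    using d by (simp add: G tf_const_def to_fract_def One_fract_def)
  \<comment> \<open>The common factor \<open>d\<close> may stay: \<open>tf_eval_Fract\<close> does
    not ask for lowest terms, and \<open>d\<close> cancels after evaluation since it is nonzero at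
    \<open>s\<close>.\<close>
  then have "feedback_tf \<sigma> G = Fract (n * d) (d * ?r)"
    by (simp add: feedback_tf_def G)
  moreover have "poly (d * ?r) s \<noteq> 0"
    using d r assms(2) by (simp only: poly_mult) simp
  ultimately have "tf_eval (feedback_tf \<sigma> G) s = poly (n * d) s / poly (d * ?r) s"
    using tf_eval_Fract by metis
  also have "\<dots> = poly n s / poly ?r s"
    using d by (simp only: poly_mult) simp
  also have "\<dots> = tf_eval G s / (1 - complex_of_real \<sigma> * tf_eval G s)"
    by (simp only: r eval_G divide_divide_eq_left)
  finally show ?thesis .
qed

lemma Re_feedback_nonneg_iff:
  assumes "1 - complex_of_real \<sigma> * g \<noteq> 0"
  shows "0 \<le> Re (g / (1 - complex_of_real \<sigma> * g)) \<longleftrightarrow> \<sigma> * (cmod g)\<^sup>2 \<le> Re g"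
proof -
  let ?w = "1 - complex_of_real \<sigma> * g"
  \<comment> \<open>The new denominator is real, so \<open>Re\<close> passes to the
    numerator.\<close>
  have "Re (g / ?w) = Re (g * cnj ?w) / (cmod ?w)\<^sup>2"
    by (subst complex_div_cnj) (simp flip: of_real_power)
  moreover have "Re (g * cnj ?w) = Re g - \<sigma> * (cmod g)\<^sup>2"
    unfolding cmod_power2 by (simp add: power2_eq_square algebra_simps)
  ultimately show ?thesis
    using assms by (simp add: zero_le_divide_iff)
qed

theorem theorem2:
  fixes G :: transfer_function and \<sigma> \<omega> :: real
  assumes "real_tf G"
    and "strictly_proper G"
    and "\<not> tf_pole G (\<i> * complex_of_real \<omega>)"
    and "1 - complex_of_real \<sigma> * tf_eval G (\<i> * complex_of_real \<omega>) \<noteq> 0"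
  shows "tf_eval (feedback_tf \<sigma> G) (\<i> * complex_of_real \<omega>)
           + cnj (tf_eval (feedback_tf \<sigma> G) (\<i> * complex_of_real \<omega>)) \<ge> 0
         \<longleftrightarrow> Re (tf_eval G (\<i> * complex_of_real \<omega>))
           \<ge> \<sigma> * (cmod (tf_eval G (\<i> * complex_of_real \<omega>)))\<^sup>2"
  \<comment> \<open>The order on complex numbers also demands equal imaginary parts; this holds
    because z + \<open>cnj\<close> z is the real number 2 Re z.\<close>
  using Re_feedback_nonneg_iff[OF assms(4)]
  unfolding tf_eval_feedback_tf[OF assms(3,4)] complex_add_cnj
  by (simp add: less_eq_complex_def)

end
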